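(* If $G$ is not a Roman graph, then $\gamma_R(\mu(G))=\gamma_R(G)+2$.
   Context: All graphs are finite and simple. A dominating set of $G$ is a set $S\subseteq V(G)$ such that every vertex outside $S$ has a neighbor in $S$; $\gamma(G)$ is the minimum size of a dominating set. A Roman dominating function (RDF) of $G=(V,E)$ is a function $f:V\to\{0,1,2\}$ such that every vertex $v$ with $f(v)=0$ has a neighbor $w$ with $f(w)=2$; its weight is $\sum_v f(v)$ and $\gamma_R(G)$ is the minimum weight of an RDF. $G$ is a Roman graph if $\gamma_R(G)=2\gamma(G)$. The Mycielskian $\mu(G)$ of $G$ with $V(G)=\{v_1^0,\ldots,v_n^0\}$ has vertex set $\{v_j^0\}\cup\{v_j^1\}\cup\{u\}$ and edge set $E(G)\cup\{v_j^0v_{j'}^1 : v_j^0v_{j'}^0\in E(G)\}\cup\{v_j^1u: 1\leq j\leq n\}$. *)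

theory Defs
  imports "Graph_Theory.Pair_Digraph"
begin

text \<open>
  Finite simple graphs are the \<^locale>\<open>pair_graph\<close>s of the library: finite, loop-free digraphs whose
  arc relation is symmetric, so an undirected edge \<open>vw\<close> is the pair of arcs \<open>(v, w)\<close>, \<open>(w, v)\<close>.
\<close>

definition dominating_set :: "'a pair_pre_digraph \<Rightarrow> 'a set \<Rightarrow> bool" where
  "dominating_set G S \<longleftrightarrow>
     S \<subseteq> pverts G \<and> (\<forall>v \<in> pverts G - S. \<exists>w \<in> S. (v, w) \<in> parcs G)"

definition domination_number :: "'a pair_pre_digraph \<Rightarrow> nat" where
  "domination_number G = (LEAST k. \<exists>S. dominating_set G S \<and> card S = k)"

text \<open>The values of a Roman dominating function outside the vertex set are irrelevant.\<close>

definition roman_dominating :: "'a pair_pre_digraph \<Rightarrow> ('a \<Rightarrow> nat) \<Rightarrow> bool" where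
  "roman_dominating G f \<longleftrightarrow>
     (\<forall>v \<in> pverts G. f v \<in> {0, 1, 2}) \<and>
     (\<forall>v \<in> pverts G. f v = 0 \<longrightarrow> (\<exists>w \<in> pverts G. (v, w) \<in> parcs G \<and> f w = 2))"

definition rdf_weight :: "'a pair_pre_digraph \<Rightarrow> ('a \<Rightarrow> nat) \<Rightarrow> nat" where
  "rdf_weight G f = (\<Sum>v \<in> pverts G. f v)"

definition roman_domination_number :: "'a pair_pre_digraph \<Rightarrow> nat" where
  "roman_domination_number G = (LEAST k. \<exists>f. roman_dominating G f \<and> rdf_weight G f = k)"

definition roman_graph :: "'a pair_pre_digraph \<Rightarrow> bool" where
  "roman_graph G \<longleftrightarrow> roman_domination_number G = 2 * domination_number G"

text \<open>\<open>Orig v\<close>, \<open>Copy v\<close> and \<open>Apex\<close> stand for \<open>v\<^sup>0\<close>, \<open>v\<^sup>1\<close> and \<open>u\<close>.\<close>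

datatype 'a myc_vertex = Orig 'a | Copy 'a | Apex

definition mycielskian :: "'a pair_pre_digraph \<Rightarrow> 'a myc_vertex pair_pre_digraph" where
  "mycielskian G =
     \<lparr> pverts = Orig ` pverts G \<union> Copy ` pverts G \<union> {Apex},
       parcs =
         {(Orig v, Orig w) |v w. (v, w) \<in> parcs G} \<union>
         {(Orig v, Copy w) |v w. (v, w) \<in> parcs G} \<union>
         {(Copy w, Orig v) |v w. (v, w) \<in> parcs G} \<union>
         {(Copy v, Apex) |v. v \<in> pverts G} \<union>
         {(Apex, Copy v) |v. v \<in> pverts G} \<rparr>"

lemma pair_graph_mycielskian:
  assumes "pair_graph G"
  shows "pair_graph (mycielskian G)"
proof -
  interpret pair_graph G by fact
  have sym: "(w, v) \<in> parcs G" if "(v, w) \<in> parcs G" for v w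
    using pair_sym_arcs that by (auto simp: symmetric_def dest: symD)
  have verts: "finite (pverts (mycielskian G))"
    by (simp add: mycielskian_def pair_finite_verts)
  have arcs: "parcs (mycielskian G) \<subseteq> pverts (mycielskian G) \<times> pverts (mycielskian G)"
    by (auto simp: mycielskian_def dest: in_arcsD1 in_arcsD2)
  show ?thesis
  proof
    show "fst e \<in> pverts (mycielskian G)" "snd e \<in> pverts (mycielskian G)"
      if "e \<in> parcs (mycielskian G)" for e
      using arcs that by auto
    show "finite (pverts (mycielskian G))" by fact
    show "finite (parcs (mycielskian G))"
      using finite_subset[OF arcs] verts by simp
    show "fst e \<noteq> snd e" if "e \<in> parcs (mycielskian G)" for e
      using that pair_no_loops by (fastforce simp: mycielskian_def)
    show "symmetric (with_proj (mycielskian G))"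
      by (auto simp: symmetric_def mycielskian_def sym_def dest: sym)
  qed
qed

text \<open>The sets minimised over are nonempty, so both \<open>LEAST\<close>s are attained minima.\<close>

lemma domination_number_attained:
  "\<exists>S. dominating_set G S \<and> card S = domination_number G"
  unfolding domination_number_def
  by (rule LeastI_ex) (auto simp: dominating_set_def)

lemma roman_domination_number_attained:
  "\<exists>f. roman_dominating G f \<and> rdf_weight G f = roman_domination_number G"
  unfolding roman_domination_number_def
  by (rule LeastI_ex) (auto simp: roman_dominating_def intro!: exI[of _ "\<lambda>_. 1"])

end

theory Submission
  imports Defs
begin

text \<open>
  Extending a minimum Roman dominating function by \<open>2\<close> on the apex gives the upper bound.
  Conversely let \<open>g\<close> be a Roman dominating function of the Mycielskian of weight \<open>W\<close>, and write
  \<open>p v\<close>, \<open>q v\<close>, \<open>c\<close> for its values at \<open>v\<^sup>0\<close>, \<open>v\<^sup>1\<close>, \<open>u\<close>. Merging \<open>p\<close> and \<open>q\<close> gives a Roman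
  dominating function of \<open>G\<close> of weight at most \<open>W - c\<close>, which settles \<open>c = 2\<close>. If \<open>c \<noteq> 2\<close>, every \<open>v\<close>
  with \<open>q v = 0\<close> has a neighbour \<open>w\<close> with \<open>p w = 2\<close>, so \<open>v\<close> can be given the value \<open>0\<close> unless
  \<open>p v = 2\<close>; and the set \<open>S\<close> of vertices with \<open>p v = 2\<close> or \<open>q v = 2\<close> can fail to dominate only a
  vertex with \<open>p v = q v = 1\<close>, where merging saves weight. If \<open>c = 1\<close>, either merging thus saves \<open>2\<close>,
  counting \<open>c\<close>, or \<open>S\<close> is dominating with \<open>2|S| < W\<close>, and then \<open>\<gamma>\<^sub>R(G) < 2\<gamma>(G)\<close> supplies the
  missing unit. If \<open>c = 0\<close>, the vertex \<open>u\<close> forces some \<open>a\<close> with \<open>q a = 2\<close>. Either the merged value at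
  \<open>a\<close> can be lowered to \<open>0\<close>, which saves \<open>2\<close>, or an obstruction to this (\<open>p a > 0\<close>, or a vertex
  \<open>t\<close> with \<open>p t = 0\<close>, \<open>q t = 1\<close>) wastes one unit of \<open>W\<close>, which takes the place of \<open>c\<close> in the
  previous argument.
\<close>

lemma domination_number_le:
  "dominating_set G S \<Longrightarrow> domination_number G \<le> card S"
  unfolding domination_number_def by (rule Least_le) blast

lemma roman_domination_number_le:
  "roman_dominating G f \<Longrightarrow> roman_domination_number G \<le> rdf_weight G f"
  unfolding roman_domination_number_def by (rule Least_le) blast

lemma sum_two_on_subset:
  assumes "finite A" "S \<subseteq> A"
  shows "(\<Sum>v\<in>A. if v \<in> S then 2 else 0) = (2 * card S :: nat)"
  using assms by (simp add: sum.If_cases Int_absorb1)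

lemma roman_domination_number_le_twice_card:
  assumes "finite (pverts G)" "dominating_set G S"
  shows "roman_domination_number G \<le> 2 * card S"
proof -
  let ?f = "\<lambda>v. if v \<in> S then 2 else 0 :: nat"
  have "roman_dominating G ?f"
    using assms(2) unfolding roman_dominating_def dominating_set_def
    by (simp add: subset_iff) (metis DiffI)
  from roman_domination_number_le[OF this] show ?thesis
    using assms sum_two_on_subset[of "pverts G" S]
    by (simp add: rdf_weight_def dominating_set_def)
qed

text \<open>Doubling a minimum dominating set always gives \<open>roman_domination_number G\<close>
  \<le> \<open>2 * domination_number G\<close>; for a non-Roman graph this is strict.\<close>

lemma not_roman_graph_less:
  assumes "finite (pverts G)" "\<not> roman_graph G" "dominating_set G S"
  shows "roman_domination_number G < 2 * card S"
proof -
  obtain D where "dominating_set G D" "card D = domination_number G"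
    using domination_number_attained[of G] by blast
  then have "roman_domination_number G \<le> 2 * domination_number G"
    using roman_domination_number_le_twice_card[OF assms(1)] by metis
  moreover have "roman_domination_number G \<noteq> 2 * domination_number G"
    using assms(2) by (simp add: roman_graph_def)
  ultimately show ?thesis
    using domination_number_le[OF assms(3)] by linarith
qed

lemma sum_add_two_le:
  fixes f g :: "'a \<Rightarrow> nat"
  assumes "finite A" "\<And>v. v \<in> A \<Longrightarrow> f v \<le> g v"
    and "s \<in> A" "t \<in> A" "s \<noteq> t" "f s < g s" "f t < g t"
  shows "sum f A + 2 \<le> sum g A"
proof -
  have "sum f (A - {s} - {t}) \<le> sum g (A - {s} - {t})"
    using assms(2) by (intro sum_mono) auto
  then show ?thesis
    using assms by (simp add: sum.remove[of A s] sum.remove[of "A - {s}" t])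
qed

lemma rdf_weight_mycielskian:
  assumes "finite (pverts G)"
  shows "rdf_weight (mycielskian G) g =
    (\<Sum>v\<in>pverts G. g (Orig v) + g (Copy v)) + g Apex"
proof -
  let ?V = "pverts G"
  have "sum g (Orig ` ?V \<union> Copy ` ?V) = sum g (Orig ` ?V) + sum g (Copy ` ?V)"
    using assms by (intro sum.union_disjoint) auto
  moreover have "sum g (Orig ` ?V) = (\<Sum>v\<in>?V. g (Orig v))"
    by (subst sum.reindex) (auto intro: inj_onI)
  moreover have "sum g (Copy ` ?V) = (\<Sum>v\<in>?V. g (Copy v))"
    by (subst sum.reindex) (auto intro: inj_onI)
  moreover have "Apex \<notin> Orig ` ?V \<union> Copy ` ?V" by auto
  ultimately show ?thesis
    using assms by (simp add: rdf_weight_def mycielskian_def sum.distrib)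
qed

lemma roman_domination_number_mycielskian_le:
  assumes "finite (pverts G)"
  shows "roman_domination_number (mycielskian G) \<le> roman_domination_number G + 2"
proof -
  obtain f where f: "roman_dominating G f" "rdf_weight G f = roman_domination_number G"
    using roman_domination_number_attained[of G] by blast
  define g where "g = case_myc_vertex f (\<lambda>_. 0) 2"
  have "roman_dominating (mycielskian G) g"
    using f(1) unfolding roman_dominating_def g_def mycielskian_def
    by (fastforce split: myc_vertex.splits)
  moreover have "rdf_weight (mycielskian G) g = roman_domination_number G + 2"
    using f(2) unfolding rdf_weight_mycielskian[OF assms] by (simp add: g_def rdf_weight_def)
  ultimately show ?thesis
    using roman_domination_number_le by metis
qed

lemma roman_domination_number_mycielskian_ge:
  assumes "pair_graph G" "\<not> roman_graph G" "roman_dominating (mycielskian G) g"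
  shows "roman_domination_number G + 2 \<le> rdf_weight (mycielskian G) g"
proof -
  interpret pair_graph G by fact
  let ?V = "pverts G" and ?W = "rdf_weight (mycielskian G) g"
  let ?R = "roman_domination_number G"
  define p q c where "p = (\<lambda>v. g (Orig v))" and "q = (\<lambda>v. g (Copy v))" and "c = g Apex"
  have fin: "finite ?V" by simp
  have W: "?W = (\<Sum>v\<in>?V. p v + q v) + c"
    by (simp add: rdf_weight_mycielskian[OF fin] p_def q_def c_def)
  have vals: "p v \<in> {0, 1, 2}" "q v \<in> {0, 1, 2}" if "v \<in> ?V" for v
    using assms(3) that unfolding roman_dominating_def p_def q_def mycielskian_def by auto
  have c_vals: "c \<in> {0, 1, 2}"
    using assms(3) unfolding roman_dominating_def c_def mycielskian_def by auto
  have g0: "\<exists>y\<in>pverts (mycielskian G). (x, y) \<in> parcs (mycielskian G) \<and> g y = 2"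
    if "x \<in> pverts (mycielskian G)" "g x = 0" for x
    using assms(3) that unfolding roman_dominating_def by blast
  have p0: "\<exists>w\<in>?V. (v, w) \<in> parcs G \<and> (p w = 2 \<or> q w = 2)" if "v \<in> ?V" "p v = 0" for v
  proof -
    have "\<exists>x\<in>pverts (mycielskian G). (Orig v, x) \<in> parcs (mycielskian G) \<and> g x = 2"
      using that by (intro g0) (auto simp: p_def mycielskian_def)
    then show ?thesis unfolding p_def q_def by (auto simp: mycielskian_def)
  qed
  have q0: "\<exists>w\<in>?V. (v, w) \<in> parcs G \<and> p w = 2" if "v \<in> ?V" "q v = 0" "c \<noteq> 2" for v
  proof -
    have "\<exists>x\<in>pverts (mycielskian G). (Copy v, x) \<in> parcs (mycielskian G) \<and> g x = 2"
      using that by (intro g0) (auto simp: q_def mycielskian_def)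
    \<comment> \<open>\<open>c \<noteq> 2\<close> rules out the apex, so the neighbour found is some
      \<open>Orig w\<close>.\<close>
    then show ?thesis
      using that(3) pair_sym_arcs unfolding p_def c_def
      by (auto simp: mycielskian_def symmetric_def dest: symD)
  qed
  have c0: "\<exists>a\<in>?V. q a = 2" if "c = 0"
  proof -
    have "\<exists>x\<in>pverts (mycielskian G). (Apex, x) \<in> parcs (mycielskian G) \<and> g x = 2"
      using that by (intro g0) (auto simp: c_def mycielskian_def)
    then show ?thesis unfolding q_def by (auto simp: mycielskian_def)
  qed
  have by_rdf: "?R + 2 \<le> ?W"
    if "roman_dominating G f" "sum f ?V + 2 \<le> ?W" for f
    using roman_domination_number_le[OF that(1)] that(2) by (simp add: rdf_weight_def)
  show ?thesis
  proof (cases "c = 2")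
    case True
    define f where "f v = (if p v = 2 \<or> q v = 2 then 2 else p v)" for v
    have "roman_dominating G f"
      unfolding roman_dominating_def
    proof (intro conjI ballI impI)
      show "f v \<in> {0, 1, 2}" if "v \<in> ?V" for v
        using vals[OF that] by (auto simp: f_def)
      show "\<exists>w\<in>?V. (v, w) \<in> parcs G \<and> f w = 2" if "v \<in> ?V" "f v = 0" for v
        using p0[OF that(1)] that(2) by (auto simp: f_def split: if_splits)
    qed
    moreover have "sum f ?V \<le> (\<Sum>v\<in>?V. p v + q v)"
      by (intro sum_mono) (auto simp: f_def)
    ultimately show ?thesis using by_rdf[of f] W True by linarith
  next
    case c_ne: False
    define f where "f v = (if p v = 2 \<or> q v = 2 then 2 else if q v = 0 then 0 else p v)" for v
    have f_le: "f v \<le> p v + q v" for v by (auto simp: f_def)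
    have f_rdf: "roman_dominating G f"
      unfolding roman_dominating_def
    proof (intro conjI ballI impI)
      show "f v \<in> {0, 1, 2}" if "v \<in> ?V" for v
        using vals[OF that] by (auto simp: f_def)
      show "\<exists>w\<in>?V. (v, w) \<in> parcs G \<and> f w = 2" if "v \<in> ?V" "f v = 0" for v
        using p0[OF that(1)] q0[OF that(1) _ c_ne] that(2)
        by (fastforce simp: f_def split: if_splits)
    qed
    define S where "S = {v \<in> ?V. p v = 2 \<or> q v = 2}"
    let ?h = "\<lambda>v. if v \<in> S then 2 else 0 :: nat"
    have S_sum: "sum ?h ?V = 2 * card S"
      by (intro sum_two_on_subset) (auto simp: S_def)
    have h_le: "?h v \<le> p v + q v" for v by (auto simp: S_def)
    \<comment> \<open>Two strict inequalities between naturals, \<open>?R < 2 * card S\<close> and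
      \<open>2 * card S < ?W\<close>, make up the gap of 2.\<close>
    have by_S: ?thesis if "dominating_set G S" "sum ?h ?V < ?W"
      using not_roman_graph_less[OF fin assms(2) that(1)] that(2) S_sum by linarith
    have undominated: "\<exists>s\<in>?V. p s = 1 \<and> q s = 1" if nd: "\<not> dominating_set G S"
    proof -
      obtain s where s: "s \<in> ?V" "s \<notin> S" "\<forall>w\<in>S. (s, w) \<notin> parcs G"
        using nd unfolding dominating_set_def S_def by blast
      \<comment> \<open>Otherwise \<open>p0\<close> or \<open>q0\<close> would put a neighbour of
        \<open>s\<close> into \<open>S\<close>.\<close>
      have "p s \<noteq> 0" "q s \<noteq> 0"
        using p0[OF s(1)] q0[OF s(1) _ c_ne] s(3) by (auto simp: S_def)
      then show ?thesis using vals[OF s(1)] s(1,2) by (auto simp: S_def)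
    qed
    show ?thesis
    proof (cases "c = 0")
      case False
      then have c1: "c = 1" using c_vals c_ne by auto
      show ?thesis
      proof (cases "dominating_set G S")
        case True
        have "sum ?h ?V \<le> (\<Sum>v\<in>?V. p v + q v)" by (intro sum_mono h_le)
        then show ?thesis using by_S[OF True] W c1 by linarith
      next
        case False
        then obtain s where "s \<in> ?V" "p s = 1" "q s = 1" using undominated by blast
        then have "sum f ?V < (\<Sum>v\<in>?V. p v + q v)"
          using f_le by (intro sum_strict_mono_ex1) (auto simp: f_def intro!: bexI[of _ s])
        then show ?thesis using by_rdf[OF f_rdf] W c1 by linarith
      qed
    next
      case True
      then obtain a where a: "a \<in> ?V" "q a = 2" using c0 by blast
      show ?thesis
      proof (cases "p a = 0 \<and> (\<forall>x\<in>?V. \<not> (p x = 0 \<and> q x = 1))")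
        case lone: True
        \<comment> \<open>Lowering \<open>a\<close> is safe: any other zero vertex has a neighbour
          \<open>w\<close> with \<open>p w = 2\<close>, hence \<open>w \<noteq> a\<close>, and
          \<open>p0\<close> serves \<open>a\<close> itself.\<close>
        let ?f = "f(a := 0)"
        have "roman_dominating G ?f"
          unfolding roman_dominating_def
        proof (intro conjI ballI impI)
          show "?f v \<in> {0, 1, 2}" if "v \<in> ?V" for v
            using vals[OF that] by (auto simp: f_def)
          show "\<exists>w\<in>?V. (v, w) \<in> parcs G \<and> ?f w = 2" if v: "v \<in> ?V" "?f v = 0" for v
          proof (cases "v = a")
            case True
            obtain w where w: "w \<in> ?V" "(a, w) \<in> parcs G" "p w = 2 \<or> q w = 2"
              using p0[OF a(1) conjunct1[OF lone]] by blast
            have "w \<noteq> a" using pair_no_loops[OF w(2)] by simp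
            then have "(v, w) \<in> parcs G \<and> ?f w = 2"
              using w(2,3) True by (simp add: f_def)
            with w(1) show ?thesis by blast
          next
            case False
            \<comment> \<open>\<open>q v = 1\<close> and \<open>f v = 0\<close> would force
              \<open>p v = 0\<close>, which \<open>lone\<close> forbids.\<close>
            then have "q v = 0"
              using v lone vals[OF v(1)] by (auto simp: f_def split: if_splits)
            then obtain w where "w \<in> ?V" "(v, w) \<in> parcs G" "p w = 2"
              using q0[OF v(1) _ c_ne] by blast
            moreover from this have "w \<noteq> a" using lone by auto
            ultimately show ?thesis by (auto simp: f_def)
          qed
        qed
        moreover have "sum ?f ?V + 2 \<le> (\<Sum>v\<in>?V. p v + q v)"
        proof -
          have "sum ?f (?V - {a}) \<le> (\<Sum>v\<in>?V - {a}. p v + q v)"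
            using f_le by (intro sum_mono) auto
          then show ?thesis using a fin by (simp add: sum.remove[of ?V a])
        qed
        ultimately show ?thesis using by_rdf[of ?f] W by linarith
      next
        case False
        \<comment> \<open>\<open>t\<close> is \<open>a\<close> itself if \<open>p a > 0\<close>, and
          otherwise a vertex violating the second condition.\<close>
        then obtain t where t: "t \<in> ?V" "q t = 2 \<and> 0 < p t \<or> q t = 1 \<and> p t = 0"
          using a by (metis gr0I)
        then have t_less: "f t < p t + q t" "?h t < p t + q t"
          by (auto simp: f_def S_def)
        show ?thesis
        proof (cases "dominating_set G S")
          case True
          have "sum ?h ?V < (\<Sum>v\<in>?V. p v + q v)"
            using h_le t(1) t_less(2) fin by (intro sum_strict_mono_ex1) blast+
          then show ?thesis using by_S[OF True] W by linarith
        next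
          case False
          then obtain s where s: "s \<in> ?V" "p s = 1" "q s = 1" using undominated by blast
          \<comment> \<open>\<open>p s = q s = 1\<close> fits neither alternative for
            \<open>t\<close>, so \<open>s\<close> and \<open>t\<close> are distinct and save a unit
            each.\<close>
          have "sum f ?V + 2 \<le> (\<Sum>v\<in>?V. p v + q v)"
            using s t t_less(1) f_le
            by (intro sum_add_two_le[of ?V f _ s t]) (auto simp: f_def)
          then show ?thesis using by_rdf[OF f_rdf] W by linarith
        qed
      qed
    qed
  qed
qed

theorem theorem3:
  fixes G :: "'a pair_pre_digraph"
  assumes "pair_graph G"
    and "\<not> roman_graph G"
  shows "roman_domination_number (mycielskian G) = roman_domination_number G + 2"
proof (rule antisym)
  interpret pair_graph G by fact
  show "roman_domination_number (mycielskian G) \<le> roman_domination_number G + 2"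
    by (intro roman_domination_number_mycielskian_le pair_finite_verts)
  show "roman_domination_number G + 2 \<le> roman_domination_number (mycielskian G)"
    using roman_domination_number_mycielskian_ge[OF assms]
      roman_domination_number_attained[of "mycielskian G"] by metis
qed

end
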